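(* Let $\mathcal{X}_{+},\mathcal{X}_{-}$ be separable real normed spaces, $K$ a nonempty compact convex subset of a real locally convex Hausdorff space, $\tau_{\pm}:K\to\mathcal{X}_{\pm}$ two continuous affine maps and $f:K\to\{-\infty\}\cup\mathbb{R}$ an upper semicontinuous concave function that is not identically $-\infty$. Let $g_{-}:\mathcal{X}_{-}\to\mathbb{R}$ be lower semicontinuous and convex, such that there is $R_{0}\in\mathbb{R}^{+}$ for which $B_{-}(0,R)\cap\mathrm{dom}(g_{-}^{\ast})$ is nonempty and weak$^{\ast}$-closed for all $R\in[R_{0},\infty)$, and such that $g_{-}^{\ast}$ has minimal linear growth $\Vert\tau_{-}\Vert_{\infty}$. Let $g_{+}:\mathcal{X}_{+}\to\mathbb{R}$ be lower semicontinuous, convex and bounded on bounded sets, such that $\mathrm{dom}(g_{+}^{\ast})=\mathcal{X}_{+}^{\ast}$ and $g_{+}^{\ast}$ has minimal linear growth $\Vert\tau_{+}\Vert_{\infty}$. Suppose additionally that $g_{+}$ and $g_{-}$ are Gateaux-differentiable, that $g_{\pm}^{\ast}:\mathcal{X}_{\pm}^{\ast}\to\mathbb{R}$ are real-valued and (weak$^{\ast}$-)continuous, and that $g_{-}^{\ast}$ is strictly convex. Let $\mathbb{F}:=f-g_{-}\circ\tau_{-}+g_{+}\circ\tau_{+}$ and let $\mathfrak{y}_{\pm}\equiv\mathfrak{y}_{\pm}(\mu)$ be the order parameter distributions associated with some $\mu\in G_{\mathbb{F}}$. Then $$\sup\mathbb{F}(K)=\sup\left\{\int_{\mathcal{X}_{+}^{\ast}}P_{\mathrm{NL}}^{+}(y_{+})\,\mathfrak{y}_{+}(\mathrm{d}y_{+})-\int_{\mathcal{X}_{-}^{\ast}}P_{\mathrm{NL}}^{-}(y_{-})\,\mathfrak{y}_{-}(\mathrm{d}y_{-})\right\},$$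 where the supremum is taken over all (weak$^{\ast}$-)continuous functions $P_{\mathrm{NL}}^{+}:\mathcal{X}_{+}^{\ast}\to\mathbb{R}$ and $P_{\mathrm{NL}}^{-}:\mathcal{X}_{-}^{\ast}\to\mathbb{R}$ such that $$P_{\mathrm{NL}}^{+}(y_{+})-P_{\mathrm{NL}}^{-}(y_{-})\le P_{\mathrm{NL}}(y_{+},y_{-}),\qquad y_{\pm}\in\mathcal{X}_{\pm}^{\ast}.$$
   Context: $\mathbb{R}^{+}=(0,\infty)$. For a real normed space $\mathcal{X}$, $\mathcal{X}^{\ast}$ is its topological dual, endowed with the weak$^{\ast}$ topology, $\Vert\cdot\Vert_{\mathrm{op}}$ is the dual norm, and $B(0,R)=\{y\in\mathcal{X}^{\ast}:\Vert y\Vert_{\mathrm{op}}\le R\}$; $B_{\pm}(0,R)$ are these balls in $\mathcal{X}_{\pm}^{\ast}$. For $g:\mathcal{X}\to\mathbb{R}$, $g^{\ast}(x)=\sup_{y\in\mathcal{X}}\{x(y)-g(y)\}\in(-\infty,\infty]$, $x\in\mathcal{X}^{\ast}$, and $\mathrm{dom}(g^{\ast})=\{x:g^{\ast}(x)<\infty\}$. $g^{\ast}$ has minimal linear growth $\lambda$ if $\lim_{R\to\infty}\sup_{y\in\mathcal{X}^{\ast}\setminus B(0,R)}\{\lambda\Vert y\Vert_{\mathrm{op}}-g^{\ast}(y)\}=-\infty$. $\Vert\tau_{\pm}\Vert_{\infty}=\sup_{\mu\in K}\Vert\tau_{\pm}(\mu)\Vert_{\mathcal{X}_{\pm}}$.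 $P_{\mathrm{NL}}(y_{+},y_{-})=\sup_{\mu\in K}\{f(\mu)-y_{-}(\tau_{-}(\mu))+y_{+}(\tau_{+}(\mu))\}+g_{-}^{\ast}(y_{-})-g_{+}^{\ast}(y_{+})$ for $y_{\pm}\in\mathcal{X}_{\pm}^{\ast}$. $E_{\mathbb{F}}=\{\mu\in K:\exists$ a net $(\mu_{j})_{j\in J}\subseteq K$ with $\lim_{J}\mu_{j}=\mu$ and $\lim_{J}\mathbb{F}(\mu_{j})=\sup\mathbb{F}(K)\}$ (a compact set, equal to the set of maximizers of $\mathbb{F}$), and $G_{\mathbb{F}}=\overline{\mathrm{co}}(E_{\mathbb{F}})\subseteq K$ is its closed convex hull. Order parameter distributions: for $\mu\in G_{\mathbb{F}}$, let $\mathfrak{m}_{\mu}$ be a (regular Borel) probability measure on $E_{\mathbb{F}}$ representing $\mu$, i.e. whose barycenter is $\mu$ ($\ell(\mu)=\int\ell\,\mathrm{d}\mathfrak{m}_{\mu}$ for every continuous linear functional $\ell$). Let $\nabla g_{\pm}:\mathcal{X}_{\pm}\to\mathcal{X}_{\pm}^{\ast}$ be the Gateaux gradient mappings. Then $\mathfrak{y}_{+}(\mu)$ and $\mathfrak{y}_{-}(\mu)$ are the pushforwards of (the same) $\mathfrak{m}_{\mu}$ through $\nabla g_{+}\circ\tau_{+}$ and $\nabla g_{-}\circ\tau_{-}$, probability measures on $\mathcal{X}_{+}^{\ast}$ and $\mathcal{X}_{-}^{\ast}$, respectively. *)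

theory Defs
  imports "HOL-Analysis.Analysis" "HOL-Probability.Probability_Measure"
begin

section \<open>Locally convex Hausdorff spaces\<close>

class locally_convex_t2_space = real_vector + topological_ab_group_add + t2_space +
  assumes tendsto_scaleR_Pair:
    "((\<lambda>p. fst p *\<^sub>R snd p) \<longlongrightarrow> r *\<^sub>R x) (nhds r \<times>\<^sub>F nhds x)"
  and locally_convex_0:
    "open U \<Longrightarrow> 0 \<in> U \<Longrightarrow> \<exists>W. open W \<and> 0 \<in> W \<and> W \<subseteq> U \<and>
       (\<forall>x\<in>W. \<forall>y\<in>W. \<forall>u\<ge>0. \<forall>v\<ge>0. u + v = 1 \<longrightarrow> u *\<^sub>R x + v *\<^sub>R y \<in> W)"

lemma locally_convex_space_0:
  fixes U :: "'a::locally_convex_t2_space set"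
  assumes "open U" "0 \<in> U"
  shows "\<exists>W. open W \<and> 0 \<in> W \<and> W \<subseteq> U \<and> convex W"
  using locally_convex_0 [OF assms] unfolding convex_def by blast

instance real_normed_vector \<subseteq> locally_convex_t2_space
proof
  fix r :: real and x :: 'a
  show "((\<lambda>p. fst p *\<^sub>R snd p) \<longlongrightarrow> r *\<^sub>R x) (nhds r \<times>\<^sub>F nhds x)"
    by (intro tendsto_scaleR filterlim_fst filterlim_snd)
next
  fix U :: "'a set"
  assume "open U" "0 \<in> U"
  then obtain e where "e > 0" "ball 0 e \<subseteq> U"
    using open_contains_ball by blast
  then show "\<exists>W. open W \<and> 0 \<in> W \<and> W \<subseteq> U \<and>
      (\<forall>x\<in>W. \<forall>y\<in>W. \<forall>u\<ge>0. \<forall>v\<ge>0. u + v = 1 \<longrightarrow> u *\<^sub>R x + v *\<^sub>R y \<in> W)"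
    using convex_ball [of "0::'a" e] unfolding convex_def
    by (intro exI [of _ "ball 0 e"]) auto
qed


section \<open>Dual space, weak* topology, Legendre-Fenchel transform\<close>

text \<open>The topological dual of \<open>'a\<close> is the type \<open>'a \<Rightarrow>\<^sub>L real\<close>, whose norm is the operator norm.
  Its type-class topology is the norm topology; the weak* topology is the topology of pointwise
  convergence, which the library calls \<open>strong_operator_topology\<close> for general codomains.\<close>

abbreviation weak_star :: "('a::real_normed_vector \<Rightarrow>\<^sub>L real) topology" where
  "weak_star \<equiv> strong_operator_topology"

definition borel_of_topology :: "'a topology \<Rightarrow> 'a measure" where
  "borel_of_topology X = sigma (topspace X) {U. openin X U}"

definition conjugate :: "('a::real_normed_vector \<Rightarrow> real) \<Rightarrow> ('a \<Rightarrow>\<^sub>L real) \<Rightarrow> ereal" where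
  "conjugate g y = (SUP x. ereal (blinfun_apply y x - g x))"

definition conjugate_dom :: "('a::real_normed_vector \<Rightarrow> real) \<Rightarrow> ('a \<Rightarrow>\<^sub>L real) set" where
  "conjugate_dom g = {y. conjugate g y < \<infinity>}"

text \<open>The supremum is taken in the extended reals, so over an empty set it is \<open>-\<infinity>\<close>.\<close>

definition minimal_linear_growth ::
    "(('a::real_normed_vector \<Rightarrow>\<^sub>L real) \<Rightarrow> ereal) \<Rightarrow> real \<Rightarrow> bool" where
  "minimal_linear_growth h c \<longleftrightarrow>
     ((\<lambda>R::real. SUP y\<in>UNIV - cball 0 R. ereal (c * norm y) - h y) \<longlongrightarrow> -\<infinity>) at_top"

definition sup_norm_on :: "'v set \<Rightarrow> ('v \<Rightarrow> 'a::real_normed_vector) \<Rightarrow> real" where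
  "sup_norm_on K \<tau> = (SUP \<mu>\<in>K. norm (\<tau> \<mu>))"


section \<open>Semicontinuity, convexity, affinity\<close>

definition lsc_on :: "'a::topological_space set \<Rightarrow> ('a \<Rightarrow> 'b::linorder) \<Rightarrow> bool" where
  "lsc_on S g \<longleftrightarrow> (\<forall>c. openin (top_of_set S) {x \<in> S. c < g x})"

definition usc_on :: "'a::topological_space set \<Rightarrow> ('a \<Rightarrow> 'b::linorder) \<Rightarrow> bool" where
  "usc_on S g \<longleftrightarrow> (\<forall>c. openin (top_of_set S) {x \<in> S. g x < c})"

text \<open>Intended for functions that do not take the value \<open>\<infinity>\<close> on \<open>S\<close>;
  at \<open>u = 0\<close> and \<open>u = 1\<close> the convention \<open>0 * (-\<infinity>) = 0\<close> makes the inequality trivial.\<close>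

definition ereal_concave_on :: "'a::real_vector set \<Rightarrow> ('a \<Rightarrow> ereal) \<Rightarrow> bool" where
  "ereal_concave_on S f \<longleftrightarrow> convex S \<and>
     (\<forall>x\<in>S. \<forall>y\<in>S. \<forall>u\<in>{0..1}.
        ereal (1 - u) * f x + ereal u * f y \<le> f ((1 - u) *\<^sub>R x + u *\<^sub>R y))"

definition strictly_convex_on :: "'a::real_vector set \<Rightarrow> ('a \<Rightarrow> real) \<Rightarrow> bool" where
  "strictly_convex_on S h \<longleftrightarrow> convex S \<and>
     (\<forall>x\<in>S. \<forall>y\<in>S. \<forall>u\<in>{0<..<1}. x \<noteq> y \<longrightarrow>
        h ((1 - u) *\<^sub>R x + u *\<^sub>R y) < (1 - u) * h x + u * h y)"

definition affine_map_on :: "'a::real_vector set \<Rightarrow> ('a \<Rightarrow> 'b::real_vector) \<Rightarrow> bool" where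
  "affine_map_on S \<tau> \<longleftrightarrow>
     (\<forall>x\<in>S. \<forall>y\<in>S. \<forall>u\<in>{0..1}.
        \<tau> ((1 - u) *\<^sub>R x + u *\<^sub>R y) = (1 - u) *\<^sub>R \<tau> x + u *\<^sub>R \<tau> y)"


section \<open>Gateaux gradients\<close>

definition has_gateaux_gradient ::
    "('a::real_normed_vector \<Rightarrow> real) \<Rightarrow> ('a \<Rightarrow>\<^sub>L real) \<Rightarrow> 'a \<Rightarrow> bool" where
  "has_gateaux_gradient g y x \<longleftrightarrow>
     (\<forall>h. ((\<lambda>t::real. (g (x + t *\<^sub>R h) - g x) / t) \<longlongrightarrow> blinfun_apply y h) (at 0))"

definition gateaux_differentiable :: "('a::real_normed_vector \<Rightarrow> real) \<Rightarrow> bool" where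
  "gateaux_differentiable g \<longleftrightarrow> (\<forall>x. \<exists>y. has_gateaux_gradient g y x)"

definition gateaux_gradient ::
    "('a::real_normed_vector \<Rightarrow> real) \<Rightarrow> 'a \<Rightarrow> ('a \<Rightarrow>\<^sub>L real)" where
  "gateaux_gradient g x = (THE y. has_gateaux_gradient g y x)"


section \<open>The variational problem\<close>

text \<open>Subscripts \<open>p\<close> and \<open>m\<close> stand for plus and minus.\<close>

definition free_functional ::
    "('v \<Rightarrow> ereal) \<Rightarrow> ('n::real_normed_vector \<Rightarrow> real) \<Rightarrow> ('v \<Rightarrow> 'n)
     \<Rightarrow> ('p::real_normed_vector \<Rightarrow> real) \<Rightarrow> ('v \<Rightarrow> 'p) \<Rightarrow> 'v \<Rightarrow> ereal" where
  "free_functional f g\<^sub>m \<tau>\<^sub>m g\<^sub>p \<tau>\<^sub>p \<mu> = f \<mu> - ereal (g\<^sub>m (\<tau>\<^sub>m \<mu>)) + ereal (g\<^sub>p (\<tau>\<^sub>p \<mu>))"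

definition P_NL ::
    "'v set \<Rightarrow> ('v \<Rightarrow> ereal) \<Rightarrow> ('n::real_normed_vector \<Rightarrow> real) \<Rightarrow> ('v \<Rightarrow> 'n)
     \<Rightarrow> ('p::real_normed_vector \<Rightarrow> real) \<Rightarrow> ('v \<Rightarrow> 'p)
     \<Rightarrow> ('p \<Rightarrow>\<^sub>L real) \<Rightarrow> ('n \<Rightarrow>\<^sub>L real) \<Rightarrow> ereal" where
  "P_NL K f g\<^sub>m \<tau>\<^sub>m g\<^sub>p \<tau>\<^sub>p y\<^sub>p y\<^sub>m =
     (SUP \<mu>\<in>K. f \<mu> - ereal (blinfun_apply y\<^sub>m (\<tau>\<^sub>m \<mu>)) + ereal (blinfun_apply y\<^sub>p (\<tau>\<^sub>p \<mu>)))
       + conjugate g\<^sub>m y\<^sub>m - conjugate g\<^sub>p y\<^sub>p"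

text \<open>Generalized maximizers are limits of approximating nets. A net in \<open>K\<close> is represented by
  its eventuality filter: a proper filter containing \<open>K\<close>. Conversely every proper filter
  containing \<open>K\<close> is the eventuality filter of some net in \<open>K\<close>.\<close>

definition generalized_maximizers ::
    "'v::topological_space set \<Rightarrow> ('v \<Rightarrow> ereal) \<Rightarrow> 'v set" where
  "generalized_maximizers K F =
     {\<mu> \<in> K. \<exists>\<N>. \<N> \<noteq> bot \<and> eventually (\<lambda>\<nu>. \<nu> \<in> K) \<N> \<and>
        ((\<lambda>\<nu>. \<nu>) \<longlongrightarrow> \<mu>) \<N> \<and> (F \<longlongrightarrow> (SUP \<nu>\<in>K. F \<nu>)) \<N>}"

definition generalized_equilibria ::
    "'v::{real_vector,topological_space} set \<Rightarrow> ('v \<Rightarrow> ereal) \<Rightarrow> 'v set" where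
  "generalized_equilibria K F = closure (convex hull (generalized_maximizers K F))"


section \<open>Representing measures and order parameter distributions\<close>

definition regular_borel_prob_on :: "'v::topological_space set \<Rightarrow> 'v measure \<Rightarrow> bool" where
  "regular_borel_prob_on E m \<longleftrightarrow>
     prob_space m \<and> space m = E \<and> sets m = sets (restrict_space borel E) \<and>
     (\<forall>A\<in>sets m.
        emeasure m A = (INF U\<in>{U. openin (top_of_set E) U \<and> A \<subseteq> U}. emeasure m U) \<and>
        emeasure m A = (SUP C\<in>{C. compact C \<and> C \<subseteq> A \<and> C \<in> sets m}. emeasure m C))"

definition represents :: "'v::{real_vector,topological_space} measure \<Rightarrow> 'v \<Rightarrow> bool" where
  "represents m \<mu> \<longleftrightarrow>
     (\<forall>l::'v \<Rightarrow> real. linear l \<and> continuous_on UNIV l \<longrightarrow> l \<mu> = (\<integral>x. l x \<partial>m))"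

definition order_parameter_distribution ::
    "'v measure \<Rightarrow> ('a::real_normed_vector \<Rightarrow> real) \<Rightarrow> ('v \<Rightarrow> 'a) \<Rightarrow> ('a \<Rightarrow>\<^sub>L real) measure" where
  "order_parameter_distribution m g \<tau> =
     distr m (borel_of_topology weak_star) (gateaux_gradient g \<circ> \<tau>)"

end

(* Let nu be a maximizer of F, y_p = grad g_p (tau_p nu) and y_m = grad g_m (tau_m nu). Linearizing
   g_p at tau_p nu leaves nu maximal for a concave functional, whose first-order condition at nu,
   with Fenchel's equality, reads P_NL y_p y_m <= sup F. Integrating an admissible pair against the
   common measure m therefore yields at most sup F. Conversely P_m = 0 suffices: for a maximizer mu,
   y |-> f mu - g_m (tau_m mu) + y (tau_p mu) - g_p^* y is a weak* continuous lower bound of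
   P_NL y y' for every y', and it equals sup F at grad g_p (tau_p mu). The maximizers form a compact
   set, so the maximum of finitely many of these bounds is within epsilon of sup F on the support.

   Minimal linear growth bounds the gradients on the ball containing tau(K) and, with the weak*
   continuity of the conjugate, makes dual balls norm compact. A closed graph argument then shows
   that the gradients are norm continuous on that ball, which gives measurability and integrability. *)
theory Submission
  imports Defs
begin

section \<open>Gateaux gradients and subgradients\<close>

lemma convex_combination: "x + t *\<^sub>R (z - x) = (1 - t) *\<^sub>R x + t *\<^sub>R (z :: 'a::real_vector)"
  by (simp add: algebra_simps)

definition is_subgradient ::
    "('a::real_normed_vector \<Rightarrow> real) \<Rightarrow> ('a \<Rightarrow>\<^sub>L real) \<Rightarrow> 'a \<Rightarrow> bool" where
  "is_subgradient g y x \<longleftrightarrow> (\<forall>z. g x + blinfun_apply y (z - x) \<le> g z)"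

lemma has_gateaux_gradient_unique:
  assumes "has_gateaux_gradient g y x" "has_gateaux_gradient g z x"
  shows "y = z"
proof (rule blinfun_eqI)
  fix h
  show "blinfun_apply y h = blinfun_apply z h"
    using assms unfolding has_gateaux_gradient_def
    by (meson LIM_unique)
qed

lemma has_gateaux_gradient_gateaux_gradient:
  assumes "gateaux_differentiable g"
  shows "has_gateaux_gradient g (gateaux_gradient g x) x"
proof -
  obtain y where y: "has_gateaux_gradient g y x"
    using assms by (auto simp: gateaux_differentiable_def)
  then show ?thesis
    unfolding gateaux_gradient_def
    by (rule theI) (rule has_gateaux_gradient_unique [OF _ y])
qed

lemma has_gateaux_gradient_at_right:
  assumes "has_gateaux_gradient g y x"
  shows "((\<lambda>t. (g (x + t *\<^sub>R h) - g x) / t) \<longlongrightarrow> blinfun_apply y h) (at_right 0)"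
  using assms unfolding has_gateaux_gradient_def
  by (meson filterlim_at_split)

text \<open>Convexity bounds the difference quotients in the direction \<open>z - x\<close> by
  \<open>g z - g x\<close> for steps in (0,1); the bound survives the limit from the right.\<close>

lemma is_subgradient_if_has_gateaux_gradient:
  assumes "convex_on UNIV g" "has_gateaux_gradient g y x"
  shows "is_subgradient g y x"
  unfolding is_subgradient_def
proof
  fix z
  have "(g (x + t *\<^sub>R (z - x)) - g x) / t \<le> g z - g x" if "0 < t" "t < 1" for t
  proof -
    have "g (x + t *\<^sub>R (z - x)) \<le> (1 - t) * g x + t * g z"
      using convex_onD [OF assms(1), of t x z] that by (simp add: convex_combination)
    then have "g (x + t *\<^sub>R (z - x)) - g x \<le> (g z - g x) * t"
      by (simp add: algebra_simps)
    then show ?thesis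
      using that by (simp add: divide_le_eq)
  qed
  then have "\<forall>\<^sub>F t in at_right 0. (g (x + t *\<^sub>R (z - x)) - g x) / t \<le> g z - g x"
    by (intro eventually_at_rightI [of 0 1]) auto
  then have "blinfun_apply y (z - x) \<le> g z - g x"
    by (intro tendsto_upperbound [OF has_gateaux_gradient_at_right [OF assms(2)]]) auto
  then show "g x + blinfun_apply y (z - x) \<le> g z"
    by simp
qed

text \<open>A subgradient lies below every right difference quotient, hence below the gradient in
  each direction. Linearity reverses the inequality on passing from \<open>h\<close> to
  \<open>- h\<close>.\<close>

lemma is_subgradient_eq_if_has_gateaux_gradient:
  assumes y: "is_subgradient g y x" and z: "has_gateaux_gradient g z x"
  shows "y = z"
proof -
  have le: "blinfun_apply y h \<le> blinfun_apply z h" for h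
  proof -
    have "blinfun_apply y h \<le> (g (x + t *\<^sub>R h) - g x) / t" if "0 < t" for t
      using that y [unfolded is_subgradient_def, rule_format, of "x + t *\<^sub>R h"]
      by (simp add: le_divide_eq blinfun.scaleR_right mult.commute)
    then have "\<forall>\<^sub>F t in at_right 0. blinfun_apply y h \<le> (g (x + t *\<^sub>R h) - g x) / t"
      by (intro eventually_at_rightI [of 0 1]) auto
    then show ?thesis
      by (intro tendsto_lowerbound [OF has_gateaux_gradient_at_right [OF z]]) auto
  qed
  show ?thesis
  proof (rule blinfun_eqI)
    fix h
    show "blinfun_apply y h = blinfun_apply z h"
      using le [of h] le [of "- h"] by (simp add: blinfun.minus_right)
  qed
qed

section \<open>Conjugates and minimal linear growth\<close>

lemma conjugate_ge: "ereal (blinfun_apply y x - g x) \<le> conjugate g y"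
  unfolding conjugate_def by (rule SUP_upper) simp

text \<open>Fenchel's equality: the subgradient inequality says that \<open>x\<close> attains the
  supremum defining the conjugate.\<close>

lemma conjugate_eq_if_is_subgradient:
  assumes "is_subgradient g y x"
  shows "conjugate g y = ereal (blinfun_apply y x - g x)"
proof (rule antisym)
  show "conjugate g y \<le> ereal (blinfun_apply y x - g x)"
    unfolding conjugate_def
  proof (rule SUP_least)
    fix z
    show "ereal (blinfun_apply y z - g z) \<le> ereal (blinfun_apply y x - g x)"
      using assms [unfolded is_subgradient_def, rule_format, of z] by (simp add: blinfun.diff_right)
  qed
qed (rule conjugate_ge)

lemma minimal_linear_growthD:
  assumes "minimal_linear_growth h c"
  obtains R where "\<And>y. ereal A \<le> ereal (c * norm y) - h y \<Longrightarrow> norm y \<le> R"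
proof -
  have "\<forall>\<^sub>F R in at_top. (SUP y\<in>UNIV - cball 0 R. ereal (c * norm y) - h y) < ereal A"
    using assms unfolding minimal_linear_growth_def tendsto_MInfty by blast
  then obtain R where R: "(SUP y\<in>UNIV - cball 0 R. ereal (c * norm y) - h y) < ereal A"
    using eventually_happens trivial_limit_at_top_linorder by blast
  have "norm y \<le> R" if "ereal A \<le> ereal (c * norm y) - h y" for y
  proof (rule ccontr)
    assume "\<not> norm y \<le> R"
    then have "ereal (c * norm y) - h y \<le> (SUP y\<in>UNIV - cball 0 R. ereal (c * norm y) - h y)"
      by (intro SUP_upper) simp
    then show False
      using R that by (meson le_less_trans not_le)
  qed
  then show thesis by (rule that)
qed

text \<open>As \<open>c * norm y\<close> is nonnegative, a value of \<open>h\<close> at most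
  \<open>A\<close> forces \<open>c * norm y - h y\<close> to be at least \<open>- A\<close>, which
  growth allows only on a bounded set.\<close>

lemma bounded_sublevel_if_minimal_linear_growth:
  assumes "minimal_linear_growth h c" "0 \<le> c" "\<And>y. \<bar>h y\<bar> \<noteq> \<infinity>"
  obtains R where "\<And>y. real_of_ereal (h y) \<le> A \<Longrightarrow> norm y \<le> R"
proof -
  obtain R where R: "\<And>y. ereal (- A) \<le> ereal (c * norm y) - h y \<Longrightarrow> norm y \<le> R"
    using minimal_linear_growthD [OF assms(1)] by blast
  have "norm y \<le> R" if "real_of_ereal (h y) \<le> A" for y
  proof (rule R)
    obtain r where r: "h y = ereal r"
      using assms(3) [of y] by (cases "h y") auto
    moreover have "0 \<le> c * norm y"
      using assms(2) by simp
    ultimately show "ereal (- A) \<le> ereal (c * norm y) - h y"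
      using that by simp
  qed
  then show thesis by (rule that)
qed

section \<open>Weak* neighbourhoods and norm compactness of dual balls\<close>

lemma openin_weak_star_contains_basis:
  assumes "openin weak_star U" "(0 :: 'a::real_normed_vector \<Rightarrow>\<^sub>L real) \<in> U"
  obtains I e where "finite I" "0 < e"
    "\<And>y. (\<And>i. i \<in> I \<Longrightarrow> \<bar>blinfun_apply y i\<bar> < e) \<Longrightarrow> y \<in> U"
proof -
  obtain V where V: "open V" "U = blinfun_apply -` V"
    using assms(1) unfolding strong_operator_topology_def openin_pullback_topology by auto
  have "openin (product_topology (\<lambda>i. euclidean) UNIV) V" "blinfun_apply 0 \<in> V"
    using V assms(2) by (auto simp: open_fun_def)
  \<comment> \<open>The weak* topology is pulled back from a product, so a basic neighbourhood
    restricts only finitely many evaluations.\<close>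
  from product_topology_open_contains_basis [OF this]
  obtain X where X: "blinfun_apply 0 \<in> (\<Pi>\<^sub>E i\<in>UNIV. X i)" "\<And>i. open (X i)"
    "finite {i. X i \<noteq> UNIV}" "(\<Pi>\<^sub>E i\<in>UNIV. X i) \<subseteq> V"
    by auto
  define I where "I = {i. X i \<noteq> UNIV}"
  have "0 \<in> X i" for i
    using X(1) by auto
  then have "\<exists>e>0. ball 0 e \<subseteq> X i" for i
    using X(2) open_contains_ball by blast
  then obtain e where e: "\<And>i. 0 < e i" "\<And>i. ball 0 (e i) \<subseteq> X i"
    by metis
  have I: "finite I"
    using X(3) by (simp add: I_def)
  \<comment> \<open>Inserting 1 keeps the minimum meaningful and positive when \<open>I\<close> is
    empty.\<close>
  define d where "d = Min (insert 1 (e ` I))"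
  have d: "0 < d" "\<And>i. i \<in> I \<Longrightarrow> d \<le> e i"
    using I e(1) by (auto simp: d_def)
  show thesis
  proof
    fix y :: "'a \<Rightarrow>\<^sub>L real"
    assume y: "\<And>i. i \<in> I \<Longrightarrow> \<bar>blinfun_apply y i\<bar> < d"
    have "blinfun_apply y i \<in> X i" for i
    proof (cases "i \<in> I")
      case True
      then have "blinfun_apply y i \<in> ball 0 (e i)"
        using y d(2) by fastforce
      then show ?thesis using e(2) by blast
    qed (simp add: I_def)
    then show "y \<in> U"
      using X(4) V(2) by auto
  qed (use I d in auto)
qed

text \<open>A weak*-neighbourhood of \<open>0\<close> contains a subspace of finite codimension, so its
  boundedness forces the dual to be finite-dimensional.\<close>

lemma compact_cball_if_weak_star_bounded:
  fixes U :: "('a::real_normed_vector \<Rightarrow>\<^sub>L real) set"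
  assumes "openin weak_star U" "0 \<in> U" "bounded U"
  shows "compact (cball (0 :: 'a \<Rightarrow>\<^sub>L real) R)"
proof -
  obtain I e where I: "finite I" and e: "0 < e"
    and U: "\<And>y. (\<And>i. i \<in> I \<Longrightarrow> \<bar>blinfun_apply y i\<bar> < e) \<Longrightarrow> y \<in> U"
    using openin_weak_star_contains_basis [OF assms(1,2)] by metis
  obtain C where C: "0 < C" "\<And>y. y \<in> U \<Longrightarrow> norm y \<le> C"
    using assms(3) by (auto simp: bounded_pos)
  \<comment> \<open>By homogeneity the evaluations at the finite set \<open>I\<close> control the
    whole norm: scaling by \<open>e / s\<close> moves \<open>y\<close> into
    \<open>U\<close>.\<close>
  have norm_le: "norm y \<le> C / e * s" if "0 < s" "\<And>i. i \<in> I \<Longrightarrow> \<bar>blinfun_apply y i\<bar> < s" for y s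
  proof -
    have "(e / s) *\<^sub>R y \<in> U"
      using that e by (intro U) (simp add: blinfun.scaleR_left abs_mult field_simps)
    then have "(e / s) * norm y \<le> C"
      using C(2) e \<open>0 < s\<close> by fastforce
    then show ?thesis
      using e \<open>0 < s\<close> by (simp add: field_simps)
  qed
  have "seq_compact (cball (0 :: 'a \<Rightarrow>\<^sub>L real) R)"
  proof (rule seq_compactI)
    fix f :: "nat \<Rightarrow> 'a \<Rightarrow>\<^sub>L real"
    assume f: "\<forall>n. f n \<in> cball 0 R"
    \<comment> \<open>Values at each point are bounded, so one subsequence converges at all points
      of the finite set \<open>I\<close> simultaneously.\<close>
    have "bounded ((\<lambda>x. x i) ` range (\<lambda>n. blinfun_apply (f n)))" for i
    proof -
      have "norm (blinfun_apply (f n) i) \<le> R * norm i" for n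
        using norm_blinfun [of "f n" i] f
        by (meson mem_cball_0 mult_right_mono norm_ge_zero order_trans)
      then show ?thesis
        by (auto simp: bounded_iff)
    qed
    from compact_lemma_general [where proj = "\<lambda>x i. x i" and unproj = "\<lambda>x. x", OF I this]
    obtain l r where r: "strict_mono (r :: nat \<Rightarrow> nat)"
      and l: "\<And>s. 0 < s \<Longrightarrow>
        \<forall>\<^sub>F n in sequentially. \<forall>i\<in>I. dist (blinfun_apply (f (r n)) i) (l i) < s"
      by blast
    have "Cauchy (f \<circ> r)"
    proof (rule metric_CauchyI)
      fix s :: real
      assume "0 < s"
      \<comment> \<open>Two terms within \<open>d\<close> of the limit differ by less than
        \<open>2 * d\<close> on \<open>I\<close>, and \<open>norm_le\<close> turns this into a
        distance of at most \<open>s / 2\<close>.\<close>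
      define d where "d = s * e / (4 * C)"
      have "0 < d"
        using \<open>0 < s\<close> e C(1) by (simp add: d_def)
      from l [OF this] obtain N
        where N: "\<And>n i. N \<le> n \<Longrightarrow> i \<in> I \<Longrightarrow> dist (blinfun_apply (f (r n)) i) (l i) < d"
        unfolding eventually_sequentially by blast
      have "dist ((f \<circ> r) m) ((f \<circ> r) n) < s" if "N \<le> m" "N \<le> n" for m n
      proof -
        have "norm (f (r m) - f (r n)) \<le> C / e * (2 * d)"
        proof (rule norm_le)
          fix i assume "i \<in> I"
          then show "\<bar>blinfun_apply (f (r m) - f (r n)) i\<bar> < 2 * d"
            using N [OF \<open>N \<le> m\<close>, of i] N [OF \<open>N \<le> n\<close>, of i]
            by (simp add: blinfun.diff_left dist_real_def)
        qed (use \<open>0 < d\<close> in simp)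
        also have "\<dots> = s / 2"
          using C(1) e by (simp add: d_def field_simps)
        finally show ?thesis
          using \<open>0 < s\<close> by (simp add: dist_norm)
      qed
      then show "\<exists>N. \<forall>m\<ge>N. \<forall>n\<ge>N. dist ((f \<circ> r) m) ((f \<circ> r) n) < s"
        by blast
    qed
    \<comment> \<open>The dual is complete because its codomain is the reals.\<close>
    then obtain y where y: "(f \<circ> r) \<longlonglongrightarrow> y"
      using convergent_eq_Cauchy by blast
    moreover have "y \<in> cball 0 R"
      by (rule closed_sequentially [OF closed_cball _ y]) (use f in simp)
    ultimately show "\<exists>l\<in>cball 0 R. \<exists>r. strict_mono r \<and> (f \<circ> r) \<longlonglongrightarrow> l"
      using r by blast
  qed
  then show ?thesis
    by (simp add: compact_eq_seq_compact_metric)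
qed

text \<open>Projection along a compact factor is a closed map, and the preimage of a closed set is
  the projection of a closed piece of the graph.\<close>

lemma continuous_on_if_closedin_graph:
  assumes "compact T" "f \<in> S \<rightarrow> T"
    and "closedin (top_of_set (S \<times> T)) ((\<lambda>x. (x, f x)) ` S)"
  shows "continuous_on S f"
proof (clarsimp simp add: continuous_on_closed_gen [OF assms(2)])
  fix U
  assume U: "closedin (top_of_set T) U"
  have eq: "(S \<inter> f -` U) = fst ` (((\<lambda>x. Pair x (f x)) ` S) \<inter> (S \<times> U))"
    by (force simp: image_iff)
  have "compact_space (top_of_set T)"
    using assms(1) by (simp add: compact_space_subtopology)
  from closed_map_fst [OF this, of "top_of_set S"]
  have "closed_map (top_of_set (S \<times> T)) (top_of_set S) fst"
    by (simp add: subtopology_Times)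
  moreover have "closedin (top_of_set (S \<times> T)) ((\<lambda>x. (x, f x)) ` S \<inter> (S \<times> U))"
    using assms(3) U by (intro closedin_Int closedin_Times) auto
  ultimately show "closedin (top_of_set S) (S \<inter> f -` U)"
    unfolding eq closed_map_def by blast
qed

section \<open>Regularity of a potential and its gradient on the ball of radius c\<close>

locale smooth_potential =
  fixes g :: "'a::real_normed_vector \<Rightarrow> real" and c :: real
  assumes convex: "convex_on UNIV g"
    and differentiable: "gateaux_differentiable g"
    and c_nonneg: "0 \<le> c"
    and growth: "minimal_linear_growth (conjugate g) c"
    and finite_conjugate: "\<And>y. \<bar>conjugate g y\<bar> \<noteq> \<infinity>"
    and continuous_conjugate:
      "continuous_map weak_star euclidean (\<lambda>y. real_of_ereal (conjugate g y))"
begin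

abbreviation "grad \<equiv> gateaux_gradient g"

lemma gradient: "has_gateaux_gradient g (grad x) x"
  by (rule has_gateaux_gradient_gateaux_gradient [OF differentiable])

lemma subgradient: "is_subgradient g (grad x) x"
  by (rule is_subgradient_if_has_gateaux_gradient [OF convex gradient])

lemma gradient_le: "g x + blinfun_apply (grad x) (z - x) \<le> g z"
  using subgradient by (simp add: is_subgradient_def)

lemma conjugate_grad: "conjugate g (grad x) = ereal (blinfun_apply (grad x) x - g x)"
  by (rule conjugate_eq_if_is_subgradient [OF subgradient])

text \<open>The conjugate's strict sublevel set at one above its value at 0 is a weak* open
  neighbourhood of 0 by continuity, and it is bounded by minimal linear growth.\<close>

lemma compact_cball: "compact (cball (0 :: 'a \<Rightarrow>\<^sub>L real) R)"
proof -
  let ?h = "\<lambda>y. real_of_ereal (conjugate g y)"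
  obtain C where C: "\<And>y. ?h y \<le> ?h 0 + 1 \<Longrightarrow> norm y \<le> C"
    using bounded_sublevel_if_minimal_linear_growth [OF growth c_nonneg finite_conjugate] by blast
  have "openin weak_star {y \<in> topspace weak_star. ?h y \<in> {..<?h 0 + 1}}"
    by (rule openin_continuous_map_preimage [OF continuous_conjugate]) simp
  then have "openin weak_star {y. ?h y < ?h 0 + 1}"
    by (simp add: strong_operator_topology_topspace)
  moreover have "bounded {y. ?h y < ?h 0 + 1}"
    using C by (auto simp: bounded_iff intro: less_imp_le)
  ultimately show ?thesis
    by (intro compact_cball_if_weak_star_bounded) auto
qed

lemma gradient_bounded:
  obtains R where "\<And>x. norm x \<le> c \<Longrightarrow> norm (grad x) \<le> R"
proof -
  \<comment> \<open>The tangent of \<open>g\<close> at 0 shows that \<open>B\<close> is a lower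
    bound of \<open>g\<close> on the ball. By Fenchel's equality it then bounds
    \<open>c * norm (grad x) - conjugate g (grad x)\<close> from below.\<close>
  define B where "B = g 0 - norm (grad 0) * c"
  obtain R where R: "\<And>y. ereal B \<le> ereal (c * norm y) - conjugate g y \<Longrightarrow> norm y \<le> R"
    using minimal_linear_growthD [OF growth] by blast
  have "norm (grad x) \<le> R" if "norm x \<le> c" for x
  proof (rule R)
    have "- (norm (grad 0) * c) \<le> blinfun_apply (grad 0) x"
      using norm_blinfun [of "grad 0" x] that mult_left_mono [OF that norm_ge_zero [of "grad 0"]]
      by simp
    then have "B \<le> g x"
      using gradient_le [of 0 x] by (simp add: B_def)
    moreover have "blinfun_apply (grad x) x \<le> c * norm (grad x)"
      using norm_blinfun [of "grad x" x] that mult_left_mono [OF that norm_ge_zero [of "grad x"]]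
      by (simp add: mult.commute)
    ultimately show "ereal B \<le> ereal (c * norm (grad x)) - conjugate g (grad x)"
      by (simp add: conjugate_grad)
  qed
  then show thesis by (rule that)
qed

text \<open>The tangent inequalities at two points of the ball make a common bound on the gradients
  a Lipschitz constant of \<open>g\<close>.\<close>

lemma continuous_on_potential: "continuous_on (cball 0 c) g"
proof -
  obtain R where R: "\<And>x. norm x \<le> c \<Longrightarrow> norm (grad x) \<le> R"
    using gradient_bounded by blast
  have le: "g x - g z \<le> R * dist x z" if "x \<in> cball 0 c" for x z :: 'a
  proof -
    have "g x - g z \<le> blinfun_apply (grad x) (x - z)"
      using gradient_le [of x z] by (simp add: blinfun.diff_right)
    also have "\<dots> \<le> norm (grad x) * norm (x - z)"
      using norm_blinfun [of "grad x" "x - z"] by simp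
    also have "\<dots> \<le> R * norm (x - z)"
      using R that by (intro mult_right_mono) auto
    finally show ?thesis by (simp add: dist_norm)
  qed
  have "0 \<le> R"
    using R [of 0] c_nonneg norm_ge_zero [of "grad 0"] by (metis norm_zero order_trans)
  have "R-lipschitz_on (cball 0 c) g"
  proof (rule lipschitz_onI)
    fix x z :: 'a assume "x \<in> cball 0 c" "z \<in> cball 0 c"
    then show "dist (g x) (g z) \<le> R * dist x z"
      using le [of x z] le [of z x] by (simp add: dist_real_def dist_commute abs_le_iff)
  qed fact
  then show ?thesis
    by (rule lipschitz_on_continuous_on)
qed

text \<open>Uniqueness of subgradients describes the graph by the subgradient inequalities alone,
  one for each \<open>z\<close>. These are closed conditions, since evaluation is jointly norm
  continuous, and the target ball is norm compact.\<close>

lemma continuous_on_grad: "continuous_on (cball 0 c) grad"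
proof -
  obtain R where R: "\<And>x. norm x \<le> c \<Longrightarrow> norm (grad x) \<le> R"
    using gradient_bounded by blast
  let ?S = "cball (0::'a) c" and ?T = "cball (0 :: 'a \<Rightarrow>\<^sub>L real) R"
  have graph: "(\<lambda>x. (x, grad x)) ` ?S =
    (\<Inter>z. {p \<in> ?S \<times> ?T. g (fst p) + blinfun_apply (snd p) (z - fst p) - g z \<in> {..0}})"
    (is "_ = ?G")
  proof (intro subset_antisym subsetI)
    fix p assume "p \<in> (\<lambda>x. (x, grad x)) ` ?S"
    then show "p \<in> ?G"
      using R gradient_le by fastforce
  next
    fix p assume p: "p \<in> ?G"
    then have "is_subgradient g (snd p) (fst p)"
      by (auto simp: is_subgradient_def)
    then have "snd p = grad (fst p)"
      by (rule is_subgradient_eq_if_has_gateaux_gradient [OF _ gradient])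
    moreover have "fst p \<in> ?S"
      using p by auto
    ultimately show "p \<in> (\<lambda>x. (x, grad x)) ` ?S"
      by (intro image_eqI [of _ _ "fst p"]) (auto simp: prod_eq_iff)
  qed
  have "closedin (top_of_set (?S \<times> ?T))
    {p \<in> ?S \<times> ?T. g (fst p) + blinfun_apply (snd p) (z - fst p) - g z \<in> {..0}}" for z
  proof -
    have "continuous_on (?S \<times> ?T) (\<lambda>p. g (fst p) + blinfun_apply (snd p) (z - fst p) - g z)"
      by (intro continuous_intros continuous_on_compose2 [OF continuous_on_potential]) auto
    from continuous_closedin_preimage [OF this closed_atMost [of 0]] show ?thesis
      by (simp add: vimage_def Int_def)
  qed
  then have "closedin (top_of_set (?S \<times> ?T)) ((\<lambda>x. (x, grad x)) ` ?S)"
    unfolding graph by (intro closedin_INT) auto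
  then show ?thesis
    using R by (intro continuous_on_if_closedin_graph [OF compact_cball]) auto
qed

end

section \<open>Measurability and integrability of weak* continuous functions\<close>

lemma continuous_on_weak_star_compose:
  assumes "continuous_map weak_star euclidean P" "continuous_on S T"
  shows "continuous_on S (\<lambda>x. P (T x))"
proof -
  have "continuous_map (top_of_set S) weak_star T"
    using continuous_map_compose [OF _ strong_operator_topology_weaker_than_euclidean,
        of "top_of_set S" T] assms(2)
    by (simp add: comp_def)
  from continuous_map_compose [OF this assms(1)] show ?thesis
    by (simp add: comp_def)
qed

lemma borel_measurable_weak_star:
  fixes P :: "('a::real_normed_vector \<Rightarrow>\<^sub>L real) \<Rightarrow> real"
  assumes "continuous_map weak_star euclidean P"
  shows "P \<in> borel_measurable (borel_of_topology weak_star)"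
proof (rule borel_measurableI)
  fix S :: "real set"
  assume "open S"
  then have "openin weak_star {y \<in> topspace weak_star. P y \<in> S}"
    using openin_continuous_map_preimage [OF assms] by simp
  then show "P -` S \<inter> space (borel_of_topology weak_star) \<in> sets (borel_of_topology weak_star)"
    unfolding borel_of_topology_def
    by (auto simp: strong_operator_topology_topspace vimage_def intro!: sigma_sets.Basic)
qed

text \<open>Weak* open sets are norm open, so norm continuity on \<open>E\<close> makes their
  preimages relatively open; these generate the target sigma-algebra.\<close>

lemma measurable_weak_star:
  fixes T :: "'v::topological_space \<Rightarrow> ('a::real_normed_vector \<Rightarrow>\<^sub>L real)"
  assumes "space m = E" "sets m = sets (restrict_space borel E)" "continuous_on E T"
  shows "T \<in> measurable m (borel_of_topology weak_star)"
  unfolding borel_of_topology_def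
proof (rule measurable_measure_of)
  fix U :: "('a \<Rightarrow>\<^sub>L real) set"
  assume "U \<in> {U. openin weak_star U}"
  then have "open U"
    using openin_continuous_map_preimage [OF strong_operator_topology_weaker_than_euclidean, of U]
    by simp
  then obtain A where A: "open A" "A \<inter> E = T -` U \<inter> E"
    using assms(3) unfolding continuous_on_open_invariant by blast
  then have "T -` U \<inter> space m = E \<inter> A" "A \<in> sets borel"
    using assms(1) by auto
  then show "T -` U \<inter> space m \<in> sets m"
    using assms(2) by (simp add: sets_restrict_space)
qed (auto simp: strong_operator_topology_topspace)

lemma integrable_weak_star_compose:
  fixes T :: "'v::topological_space \<Rightarrow> ('a::real_normed_vector \<Rightarrow>\<^sub>L real)"
  assumes "prob_space m" "space m = E" "sets m = sets (restrict_space borel E)" "compact E"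
    and "continuous_on E T" "continuous_map weak_star euclidean P"
  shows "integrable m (\<lambda>x. P (T x) :: real)"
proof -
  interpret prob_space m by fact
  have "compact ((\<lambda>x. P (T x)) ` E)"
    using continuous_on_weak_star_compose [OF assms(6,5)] assms(4) by (rule compact_continuous_image)
  then have "bounded ((\<lambda>x. P (T x)) ` E)"
    by (rule compact_imp_bounded)
  then obtain B where "\<And>x. x \<in> E \<Longrightarrow> \<bar>P (T x)\<bar> \<le> B"
    by (auto simp: bounded_iff)
  moreover have "(\<lambda>x. P (T x)) \<in> borel_measurable m"
    using measurable_compose [OF measurable_weak_star [OF assms(2,3,5)]
        borel_measurable_weak_star [OF assms(6)]] .
  ultimately show ?thesis
    using assms(2) by (intro integrable_const_bound [of _ B]) auto
qed

text \<open>The maximum takes the value of some member at every point, so an upper bound shared by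
  all members passes to it.\<close>

lemma finite_max_continuous_map:
  fixes \<phi> :: "'i \<Rightarrow> 'y \<Rightarrow> real"
  assumes "finite S" "S \<noteq> {}" "\<And>i. i \<in> S \<Longrightarrow> continuous_map X euclidean (\<phi> i)"
  obtains P where "continuous_map X euclidean P"
    "\<And>y. \<exists>i\<in>S. P y = \<phi> i y" "\<And>y i. i \<in> S \<Longrightarrow> \<phi> i y \<le> P y"
proof -
  have "\<exists>P. continuous_map X euclideanreal P \<and> (\<forall>y. \<exists>i\<in>S. P y = \<phi> i y) \<and>
      (\<forall>y. \<forall>i\<in>S. \<phi> i y \<le> P y)"
    using assms
  proof (induction S rule: finite_ne_induct)
    case (singleton i)
    have "continuous_map X euclidean (\<phi> i)"
      by (rule singleton.prems) simp
    then show ?case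
      by (intro exI [of _ "\<phi> i"] conjI allI ballI) simp_all
  next
    case (insert i S)
    then obtain P where P: "continuous_map X euclidean P" "\<forall>y. \<exists>i\<in>S. P y = \<phi> i y"
      "\<forall>y. \<forall>i\<in>S. \<phi> i y \<le> P y"
      by (metis insertI2)
    have "continuous_map X euclidean (\<lambda>y. max (\<phi> i y) (P y))"
      using P(1) insert.prems by (intro continuous_map_real_max) auto
    moreover have "\<exists>j\<in>insert i S. max (\<phi> i y) (P y) = \<phi> j y" for y
      using P(2) by (auto simp: max_def)
    moreover have "\<forall>j\<in>insert i S. \<phi> j y \<le> max (\<phi> i y) (P y)" for y
      using P(3) by (auto simp: le_max_iff_disj)
    ultimately show ?case by blast
  qed
  then show thesis using that by blast
qed

text \<open>Compactness supplies the upper bound without which a real \<open>SUP\<close> says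
  nothing.\<close>

lemma norm_le_sup_norm_on:
  assumes "compact K" "continuous_on K \<tau>" "x \<in> K"
  shows "norm (\<tau> x) \<le> sup_norm_on K \<tau>"
proof -
  have "bounded (\<tau> ` K)"
    using assms(1,2) by (simp add: compact_continuous_image compact_imp_bounded)
  then have "bdd_above ((\<lambda>\<mu>. norm (\<tau> \<mu>)) ` K)"
    by (simp add: bdd_above_norm [symmetric] image_image)
  then show ?thesis
    unfolding sup_norm_on_def using assms(3) by (intro cSUP_upper)
qed

section \<open>The maximizers of the functional and the bounds on \<open>P_NL\<close>\<close>

locale variational_problem =
  minus: smooth_potential g\<^sub>m c\<^sub>m + plus: smooth_potential g\<^sub>p c\<^sub>p
  for g\<^sub>m :: "'n::real_normed_vector \<Rightarrow> real" and c\<^sub>m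
    and g\<^sub>p :: "'p::real_normed_vector \<Rightarrow> real" and c\<^sub>p +
  fixes K :: "'v::locally_convex_t2_space set"
    and f :: "'v \<Rightarrow> ereal"
    and \<tau>\<^sub>m :: "'v \<Rightarrow> 'n"
    and \<tau>\<^sub>p :: "'v \<Rightarrow> 'p"
  assumes compact_K: "compact K" and convex_K: "convex K"
    and continuous_\<tau>\<^sub>m: "continuous_on K \<tau>\<^sub>m" and affine_\<tau>\<^sub>m: "affine_map_on K \<tau>\<^sub>m"
    and continuous_\<tau>\<^sub>p: "continuous_on K \<tau>\<^sub>p" and affine_\<tau>\<^sub>p: "affine_map_on K \<tau>\<^sub>p"
    and norm_\<tau>\<^sub>m: "\<And>\<nu>. \<nu> \<in> K \<Longrightarrow> norm (\<tau>\<^sub>m \<nu>) \<le> c\<^sub>m"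
    and norm_\<tau>\<^sub>p: "\<And>\<nu>. \<nu> \<in> K \<Longrightarrow> norm (\<tau>\<^sub>p \<nu>) \<le> c\<^sub>p"
    and f_less_top: "\<And>\<nu>. \<nu> \<in> K \<Longrightarrow> f \<nu> \<noteq> \<infinity>"
    and f_proper: "\<exists>\<nu>\<in>K. f \<nu> \<noteq> -\<infinity>"
    and usc_f: "usc_on K f" and concave_f: "ereal_concave_on K f"
begin

abbreviation "F \<equiv> free_functional f g\<^sub>m \<tau>\<^sub>m g\<^sub>p \<tau>\<^sub>p"
abbreviation "P \<equiv> P_NL K f g\<^sub>m \<tau>\<^sub>m g\<^sub>p \<tau>\<^sub>p"
abbreviation "M \<equiv> (SUP \<nu>\<in>K. F \<nu>)"
abbreviation "E \<equiv> generalized_maximizers K F"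
abbreviation "G \<nu> \<equiv> g\<^sub>p (\<tau>\<^sub>p \<nu>) - g\<^sub>m (\<tau>\<^sub>m \<nu>)"

lemma free_functional_eq: "F \<nu> = f \<nu> + ereal (G \<nu>)"
  by (cases "f \<nu>") (auto simp: free_functional_def)

lemma continuous_G: "continuous_on K G"
  using norm_\<tau>\<^sub>m norm_\<tau>\<^sub>p
  by (intro continuous_intros continuous_on_compose2 [OF plus.continuous_on_potential continuous_\<tau>\<^sub>p]
      continuous_on_compose2 [OF minus.continuous_on_potential continuous_\<tau>\<^sub>m]) auto

lemma continuous_grad\<^sub>m: "continuous_on K (\<lambda>\<nu>. minus.grad (\<tau>\<^sub>m \<nu>))"
  using norm_\<tau>\<^sub>m by (intro continuous_on_compose2 [OF minus.continuous_on_grad continuous_\<tau>\<^sub>m]) auto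

lemma continuous_grad\<^sub>p: "continuous_on K (\<lambda>\<nu>. plus.grad (\<tau>\<^sub>p \<nu>))"
  using norm_\<tau>\<^sub>p by (intro continuous_on_compose2 [OF plus.continuous_on_grad continuous_\<tau>\<^sub>p]) auto

text \<open>This is upper semicontinuity of \<open>F\<close>, the sum of an upper semicontinuous and
  a continuous function.\<close>

lemma openin_free_functional_less: "openin (top_of_set K) {\<nu> \<in> K. F \<nu> < ereal c}"
proof -
  have eq: "{\<nu> \<in> K. F \<nu> < ereal c} =
      (\<Union>a. {\<nu> \<in> K. f \<nu> < ereal a} \<inter> {\<nu> \<in> K. G \<nu> < c - a})" (is "_ = ?R")
  proof (intro subset_antisym subsetI)
    fix \<nu> assume \<nu>: "\<nu> \<in> {\<nu> \<in> K. F \<nu> < ereal c}"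
    show "\<nu> \<in> ?R"
    proof (cases "f \<nu>")
      case (real r)
      then have "r + G \<nu> < c"
        using \<nu> by (simp add: free_functional_eq)
      \<comment> \<open>The midpoint of \<open>r\<close> and \<open>c - G\<close> separates the two
        values strictly.\<close>
      then show ?thesis
        using \<nu> real by (auto intro!: exI [of _ "(r + (c - G \<nu>)) / 2"] simp: field_simps)
    next
      case PInf
      then show ?thesis using \<nu> f_less_top by auto
    next
      case MInf
      then show ?thesis using \<nu> by (auto intro!: exI [of _ "c - G \<nu> - 1"])
    qed
  next
    fix \<nu> assume "\<nu> \<in> ?R"
    then obtain a where "\<nu> \<in> K" "f \<nu> < ereal a" "G \<nu> < c - a"
      by auto
    then show "\<nu> \<in> {\<nu> \<in> K. F \<nu> < ereal c}"
      by (cases "f \<nu>") (auto simp: free_functional_eq)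
  qed
  have "openin (top_of_set K) {\<nu> \<in> K. G \<nu> < c - a}" for a
    using continuous_openin_preimage_gen [OF continuous_G open_lessThan [of "c - a"]]
    by (simp add: vimage_def Int_def)
  then show ?thesis
    unfolding eq using usc_f by (auto simp: usc_on_def)
qed

lemma free_functional_le: "\<nu> \<in> K \<Longrightarrow> F \<nu> \<le> M"
  by (rule SUP_upper)

text \<open>If the limit had a value below \<open>M\<close>, semicontinuity would keep the net below
  some level \<open>c < M\<close> eventually, while its values converge to \<open>M\<close>.\<close>

lemma generalized_maximizers_eq: "E = {\<nu> \<in> K. F \<nu> = M}"
proof (intro subset_antisym subsetI)
  fix \<nu> assume "\<nu> \<in> E"
  then obtain \<N> where \<nu>: "\<nu> \<in> K" and \<N>: "\<N> \<noteq> bot" "\<forall>\<^sub>F \<nu> in \<N>. \<nu> \<in> K" "((\<lambda>\<nu>. \<nu>) \<longlongrightarrow> \<nu>) \<N>"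
    "(F \<longlongrightarrow> M) \<N>"
    by (auto simp: generalized_maximizers_def)
  have "M \<le> F \<nu>"
  proof (rule ccontr)
    assume "\<not> M \<le> F \<nu>"
    then obtain c where c: "F \<nu> < ereal c" "ereal c < M"
      using ereal_dense2 [of "F \<nu>" M] by (auto simp: not_le)
    obtain U where U: "open U" "{\<nu> \<in> K. F \<nu> < ereal c} = K \<inter> U"
      using openin_free_functional_less [of c] by (auto simp: openin_open)
    then have "\<nu> \<in> U"
      using \<nu> c(1) by auto
    then have "\<forall>\<^sub>F \<nu> in \<N>. \<nu> \<in> U"
      using topological_tendstoD [OF \<N>(3) U(1)] by simp
    moreover have "\<forall>\<^sub>F \<nu> in \<N>. ereal c < F \<nu>"
      using \<N>(4) c(2) by (rule order_tendstoD)
    ultimately have "\<forall>\<^sub>F \<nu> in \<N>. False"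
      using \<N>(2)
    proof eventually_elim
      case (elim \<nu>)
      then have "\<nu> \<in> {\<nu> \<in> K. F \<nu> < ereal c}"
        using U(2) by blast
      then show ?case using elim(2) by auto
    qed
    then show False using \<N>(1) by simp
  qed
  then show "\<nu> \<in> {\<nu> \<in> K. F \<nu> = M}"
    using \<nu> free_functional_le by (auto intro: antisym)
next
  fix \<nu> assume "\<nu> \<in> {\<nu> \<in> K. F \<nu> = M}"
  then show "\<nu> \<in> E"
    unfolding generalized_maximizers_def
    \<comment> \<open>The principal filter at a maximizer plays the role of the constant
      net.\<close>
    by (auto intro!: exI [of _ "principal {\<nu>}"] topological_tendstoI
        simp: eventually_principal principal_eq_bot_iff)
qed

lemma generalized_maximizersD:
  assumes "\<nu> \<in> E"
  shows "\<nu> \<in> K" "F \<nu> = M"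
  using assms unfolding generalized_maximizers_eq by auto

text \<open>Removing from \<open>K\<close> the relatively open sublevel sets below \<open>M\<close>
  leaves exactly the maximizers.\<close>

lemma compact_generalized_maximizers: "compact E"
proof -
  have "E = K - (\<Union>c\<in>{c. ereal c < M}. {\<nu> \<in> K. F \<nu> < ereal c})" (is "_ = ?R")
  proof (intro subset_antisym subsetI)
    fix \<nu> assume "\<nu> \<in> E"
    then show "\<nu> \<in> ?R"
      unfolding generalized_maximizers_eq by auto
  next
    fix \<nu> assume \<nu>: "\<nu> \<in> ?R"
    have "\<not> F \<nu> < M"
    proof
      assume "F \<nu> < M"
      then obtain c where "F \<nu> < ereal c" "ereal c < M"
        using ereal_dense2 by blast
      then show False using \<nu> by auto
    qed
    then show "\<nu> \<in> E"
      using \<nu> free_functional_le [of \<nu>] unfolding generalized_maximizers_eq by auto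
  qed
  moreover have "closedin (top_of_set K) ?R"
    by (intro closedin_diff openin_Union) (auto simp: openin_free_functional_less)
  ultimately show ?thesis
    using compact_K closedin_compact by metis
qed

lemma generalized_maximizers_real:
  assumes "\<nu> \<in> E"
  obtains r where "f \<nu> = ereal r" "M = ereal (r + G \<nu>)"
proof (cases "f \<nu>")
  case (real r)
  then show thesis
    using that generalized_maximizersD(2) [OF assms] by (simp add: free_functional_eq)
next
  case PInf
  then show thesis
    using f_less_top generalized_maximizersD(1) [OF assms] by auto
next
  case MInf
  \<comment> \<open>Such a maximizer would make \<open>F\<close> identically minus infinity on
    \<open>K\<close>, against properness of \<open>f\<close>.\<close>
  then have "M = -\<infinity>"
    using generalized_maximizersD(2) [OF assms] by (simp add: free_functional_eq)
  moreover obtain \<mu> where "\<mu> \<in> K" "f \<mu> \<noteq> -\<infinity>"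
    using f_proper by blast
  ultimately show thesis
    using free_functional_le [of \<mu>] by (cases "f \<mu>") (auto simp: free_functional_eq)
qed

text \<open>Replacing \<open>g\<^sub>p\<close> by its tangent at \<open>\<tau>\<^sub>p \<nu>\<close> keeps \<open>\<nu>\<close> maximal and makes the functional concave;
  the inequality is its first-order condition at \<open>\<nu>\<close> in the direction \<open>\<mu> - \<nu>\<close>.\<close>

lemma first_order_condition:
  assumes \<nu>: "\<nu> \<in> E" and \<mu>: "\<mu> \<in> K" and r: "f \<nu> = ereal r" and s: "f \<mu> = ereal s"
  shows "s - blinfun_apply (minus.grad (\<tau>\<^sub>m \<nu>)) (\<tau>\<^sub>m \<mu>) + blinfun_apply (plus.grad (\<tau>\<^sub>p \<nu>)) (\<tau>\<^sub>p \<mu>)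
    \<le> r - blinfun_apply (minus.grad (\<tau>\<^sub>m \<nu>)) (\<tau>\<^sub>m \<nu>) + blinfun_apply (plus.grad (\<tau>\<^sub>p \<nu>)) (\<tau>\<^sub>p \<nu>)"
proof -
  let ?\<Delta> = "\<tau>\<^sub>m \<mu> - \<tau>\<^sub>m \<nu>" and ?y = "blinfun_apply (plus.grad (\<tau>\<^sub>p \<nu>)) (\<tau>\<^sub>p \<mu> - \<tau>\<^sub>p \<nu>)"
  have "\<nu> \<in> K"
    using \<nu> by (rule generalized_maximizersD)
  have "s - r + ?y \<le> (g\<^sub>m (\<tau>\<^sub>m \<nu> + t *\<^sub>R ?\<Delta>) - g\<^sub>m (\<tau>\<^sub>m \<nu>)) / t" if "0 < t" "t < 1" for t
  proof -
    let ?\<nu> = "(1 - t) *\<^sub>R \<nu> + t *\<^sub>R \<mu>"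
    have K: "?\<nu> \<in> K"
      using convexD_alt [OF convex_K \<open>\<nu> \<in> K\<close> \<mu>, of t] that by simp
    have \<tau>: "\<tau>\<^sub>m ?\<nu> = \<tau>\<^sub>m \<nu> + t *\<^sub>R ?\<Delta>" "\<tau>\<^sub>p ?\<nu> = \<tau>\<^sub>p \<nu> + t *\<^sub>R (\<tau>\<^sub>p \<mu> - \<tau>\<^sub>p \<nu>)"
      using affine_\<tau>\<^sub>m affine_\<tau>\<^sub>p \<open>\<nu> \<in> K\<close> \<mu> that by (auto simp: affine_map_on_def convex_combination)
    have "ereal (1 - t) * f \<nu> + ereal t * f \<mu> \<le> f ?\<nu>"
      using concave_f \<open>\<nu> \<in> K\<close> \<mu> that by (auto simp: ereal_concave_on_def)
    \<comment> \<open>Concavity between two finite values excludes minus infinity here, so the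
      comparison can continue in the reals.\<close>
    then obtain q where q: "f ?\<nu> = ereal q" "(1 - t) * r + t * s \<le> q"
      using f_less_top [OF K] r s by (cases "f ?\<nu>") auto
    have "F ?\<nu> \<le> F \<nu>"
      using free_functional_le [OF K] generalized_maximizersD(2) [OF \<nu>] by simp
    then have "q + G ?\<nu> \<le> r + G \<nu>"
      using q(1) r by (simp add: free_functional_eq)
    moreover have "g\<^sub>p (\<tau>\<^sub>p \<nu>) + t * ?y \<le> g\<^sub>p (\<tau>\<^sub>p ?\<nu>)"
      using plus.gradient_le [of "\<tau>\<^sub>p \<nu>" "\<tau>\<^sub>p ?\<nu>"] unfolding \<tau> by (simp add: blinfun.scaleR_right)
    \<comment> \<open>Maximality at the intermediate point, concavity of \<open>f\<close> and the
      tangent of \<open>g\<^sub>p\<close> leave only terms of order \<open>t\<close> besides the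
      increment of \<open>g\<^sub>m\<close>.\<close>
    ultimately have "(s - r + ?y) * t \<le> g\<^sub>m (\<tau>\<^sub>m ?\<nu>) - g\<^sub>m (\<tau>\<^sub>m \<nu>)"
      using q(2) by (simp add: algebra_simps)
    then show ?thesis
      using that by (simp add: \<tau> le_divide_eq)
  qed
  then have "\<forall>\<^sub>F t in at_right 0. s - r + ?y \<le> (g\<^sub>m (\<tau>\<^sub>m \<nu> + t *\<^sub>R ?\<Delta>) - g\<^sub>m (\<tau>\<^sub>m \<nu>)) / t"
    by (intro eventually_at_rightI [of 0 1]) auto
  then have "s - r + ?y \<le> blinfun_apply (minus.grad (\<tau>\<^sub>m \<nu>)) ?\<Delta>"
    by (intro tendsto_lowerbound [OF has_gateaux_gradient_at_right [OF minus.gradient]]) auto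
  then show ?thesis
    by (simp add: blinfun.diff_right)
qed

text \<open>The first-order condition places the inner supremum at \<nu>. Fenchel's equality for
  both gradients then cancels the linear terms, leaving the value of \<open>F\<close> there.\<close>

lemma P_NL_grad_le:
  assumes "\<nu> \<in> E"
  shows "P (plus.grad (\<tau>\<^sub>p \<nu>)) (minus.grad (\<tau>\<^sub>m \<nu>)) \<le> M"
proof -
  let ?m = "blinfun_apply (minus.grad (\<tau>\<^sub>m \<nu>))" and ?p = "blinfun_apply (plus.grad (\<tau>\<^sub>p \<nu>))"
  obtain r where r: "f \<nu> = ereal r" "M = ereal (r + G \<nu>)"
    using generalized_maximizers_real [OF assms] .
  have "(SUP \<mu>\<in>K. f \<mu> - ereal (?m (\<tau>\<^sub>m \<mu>)) + ereal (?p (\<tau>\<^sub>p \<mu>)))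
      \<le> ereal (r - ?m (\<tau>\<^sub>m \<nu>) + ?p (\<tau>\<^sub>p \<nu>))" (is "?S \<le> _")
  proof (rule SUP_least)
    fix \<mu> assume \<mu>: "\<mu> \<in> K"
    show "f \<mu> - ereal (?m (\<tau>\<^sub>m \<mu>)) + ereal (?p (\<tau>\<^sub>p \<mu>)) \<le> ereal (r - ?m (\<tau>\<^sub>m \<nu>) + ?p (\<tau>\<^sub>p \<nu>))"
      using first_order_condition [OF assms \<mu> r(1)] f_less_top [OF \<mu>] by (cases "f \<mu>") auto
  qed
  then show ?thesis
    unfolding P_NL_def minus.conjugate_grad plus.conjugate_grad r(2)
    by (cases ?S) auto
qed

text \<open>Testing the inner supremum at \<mu> and applying Fenchel's inequality to
  \<open>g\<^sub>m\<close> eliminates \<open>y\<^sub>m\<close> from the lower bound.\<close>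

lemma P_NL_ge:
  assumes "\<mu> \<in> K" and r: "f \<mu> = ereal r"
  shows "ereal (r - g\<^sub>m (\<tau>\<^sub>m \<mu>) + blinfun_apply y\<^sub>p (\<tau>\<^sub>p \<mu>) - real_of_ereal (conjugate g\<^sub>p y\<^sub>p)) \<le> P y\<^sub>p y\<^sub>m"
proof -
  have "f \<mu> - ereal (blinfun_apply y\<^sub>m (\<tau>\<^sub>m \<mu>)) + ereal (blinfun_apply y\<^sub>p (\<tau>\<^sub>p \<mu>))
     \<le> (SUP \<mu>\<in>K. f \<mu> - ereal (blinfun_apply y\<^sub>m (\<tau>\<^sub>m \<mu>)) + ereal (blinfun_apply y\<^sub>p (\<tau>\<^sub>p \<mu>)))"
    (is "_ \<le> ?S")
    using assms(1) by (rule SUP_upper)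
  moreover obtain a where a: "conjugate g\<^sub>m y\<^sub>m = ereal a"
    using minus.finite_conjugate [of y\<^sub>m] by auto
  moreover obtain b where b: "conjugate g\<^sub>p y\<^sub>p = ereal b"
    using plus.finite_conjugate [of y\<^sub>p] by auto
  moreover have "blinfun_apply y\<^sub>m (\<tau>\<^sub>m \<mu>) - g\<^sub>m (\<tau>\<^sub>m \<mu>) \<le> a"
    using conjugate_ge [of y\<^sub>m "\<tau>\<^sub>m \<mu>" g\<^sub>m] a by simp
  ultimately show ?thesis
    unfolding P_NL_def using r by (cases ?S) auto
qed

text \<open>A supremum over all maximizers need not be continuous; compactness of \<open>E\<close>
  allows a finite maximum at the cost of \<epsilon>.\<close>

lemma near_optimal_potential:
  assumes "E \<noteq> {}" "0 < \<epsilon>"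
  obtains Q where "continuous_map weak_star euclidean Q"
    "\<And>y\<^sub>p y\<^sub>m. ereal (Q y\<^sub>p) \<le> P y\<^sub>p y\<^sub>m"
    "\<And>\<nu>. \<nu> \<in> E \<Longrightarrow> M - ereal \<epsilon> \<le> ereal (Q (plus.grad (\<tau>\<^sub>p \<nu>)))"
proof -
  obtain M' where M': "M = ereal M'"
    using assms(1) generalized_maximizers_real by blast
  define \<phi> where "\<phi> \<mu> y = real_of_ereal (f \<mu>) - g\<^sub>m (\<tau>\<^sub>m \<mu>) + blinfun_apply y (\<tau>\<^sub>p \<mu>)
    - real_of_ereal (conjugate g\<^sub>p y)" for \<mu> y
  have \<phi>_le: "ereal (\<phi> \<mu> y\<^sub>p) \<le> P y\<^sub>p y\<^sub>m" if "\<mu> \<in> E" for \<mu> y\<^sub>p y\<^sub>m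
    using generalized_maximizers_real [OF that] generalized_maximizersD(1) [OF that] P_NL_ge
    by (metis \<phi>_def real_of_ereal.simps(1))
  have \<phi>_cont: "continuous_map weak_star euclidean (\<phi> \<mu>)" for \<mu>
    unfolding \<phi>_def
    by (intro continuous_map_diff continuous_map_add continuous_map_const [THEN iffD2]
        strong_operator_topology_continuous_evaluation plus.continuous_conjugate) auto
  have \<phi>_eq: "\<phi> \<nu> (plus.grad (\<tau>\<^sub>p \<nu>)) = M'" if \<nu>: "\<nu> \<in> E" for \<nu>
  proof -
    obtain r where "f \<nu> = ereal r" "M = ereal (r + G \<nu>)"
      using generalized_maximizers_real [OF \<nu>] .
    then show ?thesis
      using M' by (simp add: \<phi>_def plus.conjugate_grad)
  qed
  define V where "V \<mu> = {\<nu> \<in> E. M' - \<epsilon> < \<phi> \<mu> (plus.grad (\<tau>\<^sub>p \<nu>))}" for \<mu>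
  have "E \<subseteq> K"
    using generalized_maximizersD(1) by blast
  have "openin (top_of_set E) (V \<mu>)" for \<mu>
  proof -
    have "continuous_on E (\<lambda>\<nu>. \<phi> \<mu> (plus.grad (\<tau>\<^sub>p \<nu>)))"
      by (rule continuous_on_weak_star_compose
          [OF \<phi>_cont continuous_on_subset [OF continuous_grad\<^sub>p \<open>E \<subseteq> K\<close>]])
    from continuous_openin_preimage_gen [OF this open_greaterThan [of "M' - \<epsilon>"]] show ?thesis
      by (simp add: V_def vimage_def Int_def)
  qed
  then have "\<forall>\<mu>. \<exists>U. open U \<and> V \<mu> = E \<inter> U"
    by (simp add: openin_open)
  then obtain U where U: "\<And>\<mu>. open (U \<mu>)" "\<And>\<mu>. V \<mu> = E \<inter> U \<mu>"
    by metis
  \<comment> \<open>Each \<nu> belongs to its own set \<open>V\<close>, because its minorant equals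
    \<open>M'\<close> at its own gradient.\<close>
  have "E \<subseteq> (\<Union>\<mu>\<in>E. U \<mu>)"
    using \<phi>_eq assms(2) U(2) by (fastforce simp: V_def)
  then obtain S where S: "S \<subseteq> E" "finite S" "E \<subseteq> (\<Union>\<mu>\<in>S. U \<mu>)"
    using compactE_image [OF compact_generalized_maximizers, of E U] U(1) by blast
  then have "S \<noteq> {}"
    using assms(1) by auto
  obtain Q where Q: "continuous_map weak_star euclidean Q" "\<And>y. \<exists>\<mu>\<in>S. Q y = \<phi> \<mu> y"
    "\<And>y \<mu>. \<mu> \<in> S \<Longrightarrow> \<phi> \<mu> y \<le> Q y"
    using finite_max_continuous_map [OF S(2) \<open>S \<noteq> {}\<close>, of weak_star \<phi>] \<phi>_cont by blast
  show thesis
  proof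
    show "ereal (Q y\<^sub>p) \<le> P y\<^sub>p y\<^sub>m" for y\<^sub>p y\<^sub>m
      using Q(2) [of y\<^sub>p] \<phi>_le S(1) by force
    fix \<nu> assume \<nu>: "\<nu> \<in> E"
    then obtain \<mu> where \<mu>: "\<mu> \<in> S" "\<nu> \<in> V \<mu>"
      using S(3) U(2) by blast
    then have "M' - \<epsilon> \<le> Q (plus.grad (\<tau>\<^sub>p \<nu>))"
      using Q(3) [of \<mu> "plus.grad (\<tau>\<^sub>p \<nu>)"] by (auto simp: V_def)
    then show "M - ereal \<epsilon> \<le> ereal (Q (plus.grad (\<tau>\<^sub>p \<nu>)))"
      using M' by simp
  qed fact
qed

text \<open>Both distributions are images of the same \<open>m\<close>, so a difference of integrals
  becomes one integral over pairs of gradients taken at a common maximizer, where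
  \<open>P_NL_grad_le\<close> applies.\<close>

theorem duality:
  assumes m: "regular_borel_prob_on E m"
  defines "\<eta>\<^sub>p \<equiv> order_parameter_distribution m g\<^sub>p \<tau>\<^sub>p"
    and "\<eta>\<^sub>m \<equiv> order_parameter_distribution m g\<^sub>m \<tau>\<^sub>m"
  shows "M = Sup {ereal ((\<integral>y. P\<^sub>p y \<partial>\<eta>\<^sub>p) - (\<integral>y. P\<^sub>m y \<partial>\<eta>\<^sub>m)) | P\<^sub>p P\<^sub>m.
      continuous_map weak_star euclidean P\<^sub>p \<and>
      continuous_map weak_star euclidean P\<^sub>m \<and>
      (\<forall>y\<^sub>p y\<^sub>m. ereal (P\<^sub>p y\<^sub>p - P\<^sub>m y\<^sub>m) \<le> P y\<^sub>p y\<^sub>m)}"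
    (is "_ = Sup ?A")
proof (rule antisym)
  have m': "prob_space m" "space m = E" "sets m = sets (restrict_space borel E)"
    using m by (auto simp: regular_borel_prob_on_def)
  interpret m: prob_space m by fact
  have "E \<noteq> {}"
    using m.not_empty m'(2) by simp
  \<comment> \<open>A probability measure lives on a nonempty space, so a maximizer exists and
    \<open>M\<close> is finite.\<close>
  then obtain M' where M': "M = ereal M'"
    using generalized_maximizers_real by blast
  have "E \<subseteq> K"
    using generalized_maximizersD(1) by blast
  note cont\<^sub>p = continuous_on_subset [OF continuous_grad\<^sub>p \<open>E \<subseteq> K\<close>]
  note cont\<^sub>m = continuous_on_subset [OF continuous_grad\<^sub>m \<open>E \<subseteq> K\<close>]
  have int\<^sub>p: "integrable m (\<lambda>\<nu>. Q (plus.grad (\<tau>\<^sub>p \<nu>)))"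
    "(\<integral>y. Q y \<partial>\<eta>\<^sub>p) = (\<integral>\<nu>. Q (plus.grad (\<tau>\<^sub>p \<nu>)) \<partial>m)"
    if "continuous_map weak_star euclidean Q" for Q :: "_ \<Rightarrow> real"
    using integrable_weak_star_compose [OF m' compact_generalized_maximizers cont\<^sub>p that]
      integral_distr [OF measurable_weak_star [OF m'(2,3) cont\<^sub>p] borel_measurable_weak_star [OF that]]
    by (simp_all add: \<eta>\<^sub>p_def order_parameter_distribution_def comp_def)
  have int\<^sub>m: "integrable m (\<lambda>\<nu>. Q (minus.grad (\<tau>\<^sub>m \<nu>)))"
    "(\<integral>y. Q y \<partial>\<eta>\<^sub>m) = (\<integral>\<nu>. Q (minus.grad (\<tau>\<^sub>m \<nu>)) \<partial>m)"
    if "continuous_map weak_star euclidean Q" for Q :: "_ \<Rightarrow> real"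
    using integrable_weak_star_compose [OF m' compact_generalized_maximizers cont\<^sub>m that]
      integral_distr [OF measurable_weak_star [OF m'(2,3) cont\<^sub>m] borel_measurable_weak_star [OF that]]
    by (simp_all add: \<eta>\<^sub>m_def order_parameter_distribution_def comp_def)
  show "Sup ?A \<le> M"
  proof (rule Sup_least)
    fix x assume "x \<in> ?A"
    then obtain P\<^sub>p P\<^sub>m where x: "x = ereal ((\<integral>y. P\<^sub>p y \<partial>\<eta>\<^sub>p) - (\<integral>y. P\<^sub>m y \<partial>\<eta>\<^sub>m))"
      and cont: "continuous_map weak_star euclidean P\<^sub>p" "continuous_map weak_star euclidean P\<^sub>m"
      and le: "\<And>y\<^sub>p y\<^sub>m. ereal (P\<^sub>p y\<^sub>p - P\<^sub>m y\<^sub>m) \<le> P y\<^sub>p y\<^sub>m"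
      by auto
    have "P\<^sub>p (plus.grad (\<tau>\<^sub>p \<nu>)) - P\<^sub>m (minus.grad (\<tau>\<^sub>m \<nu>)) \<le> M'" if "\<nu> \<in> space m" for \<nu>
      using order_trans [OF le P_NL_grad_le [of \<nu>]] that m'(2) M' by simp
    then have "(\<integral>\<nu>. P\<^sub>p (plus.grad (\<tau>\<^sub>p \<nu>)) - P\<^sub>m (minus.grad (\<tau>\<^sub>m \<nu>)) \<partial>m) \<le> M'"
      using int\<^sub>p(1) [OF cont(1)] int\<^sub>m(1) [OF cont(2)] by (intro m.integral_le_const) auto
    then show "x \<le> M"
      using int\<^sub>p [OF cont(1)] int\<^sub>m [OF cont(2)] M' x by simp
  qed
  show "M \<le> Sup ?A"
  proof (rule ereal_le_epsilon2)
    fix \<epsilon> :: real assume "0 < \<epsilon>"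
    then obtain Q where Q: "continuous_map weak_star euclidean Q"
      "\<And>y\<^sub>p y\<^sub>m. ereal (Q y\<^sub>p) \<le> P y\<^sub>p y\<^sub>m"
      "\<And>\<nu>. \<nu> \<in> E \<Longrightarrow> M - ereal \<epsilon> \<le> ereal (Q (plus.grad (\<tau>\<^sub>p \<nu>)))"
      using near_optimal_potential [OF \<open>E \<noteq> {}\<close>] by blast
    have "M' - \<epsilon> \<le> (\<integral>\<nu>. Q (plus.grad (\<tau>\<^sub>p \<nu>)) \<partial>m)"
      using int\<^sub>p(1) [OF Q(1)] Q(3) M' m'(2) by (intro m.integral_ge_const) auto
    \<comment> \<open>The zero function is an admissible partner because the lower bound
      \<open>Q\<close> holds for every \<open>y\<^sub>m\<close>.\<close>
    moreover have "ereal ((\<integral>y. Q y \<partial>\<eta>\<^sub>p) - (\<integral>y. 0 \<partial>\<eta>\<^sub>m)) \<in> ?A"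
      using Q(1,2) by (intro CollectI exI [of _ Q] exI [of _ "\<lambda>_. 0"]) auto
    then have "ereal ((\<integral>y. Q y \<partial>\<eta>\<^sub>p) - (\<integral>y. 0 \<partial>\<eta>\<^sub>m)) \<le> Sup ?A"
      by (rule Sup_upper)
    ultimately have "ereal (M' - \<epsilon>) \<le> Sup ?A"
      using int\<^sub>p(2) [OF Q(1)] by (auto intro: order_trans [rotated])
    then show "M \<le> Sup ?A + ereal \<epsilon>"
      unfolding M' by (cases "Sup ?A") auto
  qed
qed

end

theorem theorem3p16:
  fixes K :: "'v::locally_convex_t2_space set"
    and \<tau>\<^sub>p :: "'v \<Rightarrow> 'p::real_normed_vector"
    and \<tau>\<^sub>m :: "'v \<Rightarrow> 'n::real_normed_vector"
    and f :: "'v \<Rightarrow> ereal"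
    and g\<^sub>p :: "'p \<Rightarrow> real"
    and g\<^sub>m :: "'n \<Rightarrow> real"
    and F :: "'v \<Rightarrow> ereal"
    and \<mu> :: 'v
    and m :: "'v measure"
    and \<eta>\<^sub>p :: "('p \<Rightarrow>\<^sub>L real) measure"
    and \<eta>\<^sub>m :: "('n \<Rightarrow>\<^sub>L real) measure"
  assumes "separable_space (euclidean :: 'p topology)"
    and "separable_space (euclidean :: 'n topology)"
    and "K \<noteq> {}" and "compact K" and "convex K"
    and "continuous_on K \<tau>\<^sub>p" and "affine_map_on K \<tau>\<^sub>p"
    and "continuous_on K \<tau>\<^sub>m" and "affine_map_on K \<tau>\<^sub>m"
    and "\<forall>\<nu>\<in>K. f \<nu> \<noteq> \<infinity>" and "\<exists>\<nu>\<in>K. f \<nu> \<noteq> -\<infinity>"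
    and "usc_on K f" and "ereal_concave_on K f"
    and "lsc_on UNIV g\<^sub>m" and "convex_on UNIV g\<^sub>m"
    and "\<exists>R\<^sub>0>0. \<forall>R\<ge>R\<^sub>0. cball 0 R \<inter> conjugate_dom g\<^sub>m \<noteq> {} \<and>
           closedin weak_star (cball 0 R \<inter> conjugate_dom g\<^sub>m)"
    and "minimal_linear_growth (conjugate g\<^sub>m) (sup_norm_on K \<tau>\<^sub>m)"
    and "lsc_on UNIV g\<^sub>p" and "convex_on UNIV g\<^sub>p"
    and "\<forall>S. bounded S \<longrightarrow> bounded (g\<^sub>p ` S)"
    and "conjugate_dom g\<^sub>p = UNIV"
    and "minimal_linear_growth (conjugate g\<^sub>p) (sup_norm_on K \<tau>\<^sub>p)"
    and "gateaux_differentiable g\<^sub>p" and "gateaux_differentiable g\<^sub>m"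
    and "\<forall>y. \<bar>conjugate g\<^sub>p y\<bar> \<noteq> \<infinity>" and "\<forall>y. \<bar>conjugate g\<^sub>m y\<bar> \<noteq> \<infinity>"
    and "continuous_map weak_star euclidean (\<lambda>y. real_of_ereal (conjugate g\<^sub>p y))"
    and "continuous_map weak_star euclidean (\<lambda>y. real_of_ereal (conjugate g\<^sub>m y))"
    and "strictly_convex_on UNIV (\<lambda>y. real_of_ereal (conjugate g\<^sub>m y))"
    and "F = free_functional f g\<^sub>m \<tau>\<^sub>m g\<^sub>p \<tau>\<^sub>p"
    and "\<mu> \<in> generalized_equilibria K F"
    and "regular_borel_prob_on (generalized_maximizers K F) m"
    and "represents m \<mu>"
    and "\<eta>\<^sub>p = order_parameter_distribution m g\<^sub>p \<tau>\<^sub>p"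
    and "\<eta>\<^sub>m = order_parameter_distribution m g\<^sub>m \<tau>\<^sub>m"
  shows "(SUP \<nu>\<in>K. F \<nu>) =
    Sup {ereal ((\<integral>y. P\<^sub>p y \<partial>\<eta>\<^sub>p) - (\<integral>y. P\<^sub>m y \<partial>\<eta>\<^sub>m)) | P\<^sub>p P\<^sub>m.
      continuous_map weak_star euclidean P\<^sub>p \<and>
      continuous_map weak_star euclidean P\<^sub>m \<and>
      (\<forall>y\<^sub>p y\<^sub>m. ereal (P\<^sub>p y\<^sub>p - P\<^sub>m y\<^sub>m) \<le> P_NL K f g\<^sub>m \<tau>\<^sub>m g\<^sub>p \<tau>\<^sub>p y\<^sub>p y\<^sub>m)}"
proof -
  note norm_le\<^sub>m = norm_le_sup_norm_on [OF assms(4,8)]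
  note norm_le\<^sub>p = norm_le_sup_norm_on [OF assms(4,6)]
  obtain \<nu> where "\<nu> \<in> K"
    using assms(3) by blast
  have "0 \<le> sup_norm_on K \<tau>\<^sub>m" "0 \<le> sup_norm_on K \<tau>\<^sub>p"
    using order_trans [OF norm_ge_zero norm_le\<^sub>m [OF \<open>\<nu> \<in> K\<close>]]
      order_trans [OF norm_ge_zero norm_le\<^sub>p [OF \<open>\<nu> \<in> K\<close>]] by auto
  \<comment> \<open>The radius of each ball is the assumed growth rate of the conjugate, and the
    ball contains the image of \<open>K\<close>.\<close>
  then interpret vp: variational_problem g\<^sub>m "sup_norm_on K \<tau>\<^sub>m" g\<^sub>p "sup_norm_on K \<tau>\<^sub>p" K f \<tau>\<^sub>m \<tau>\<^sub>p
    using assms(4-13,15,17,19,22-28) norm_le\<^sub>m norm_le\<^sub>p by unfold_locales auto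
  show ?thesis
    using vp.duality assms(32) unfolding assms(30,34,35) by blast
qed

end
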